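(* Let $n\ge 0$. Let $\mathcal{C}=[1,3]^{n+1}\subset[0,4]^{n+1}$, which is the union of the unit cubes of the integer-lattice tiling of $[0,4]^{n+1}$ containing the point $(2,\dots,2)$; let $\mathcal{C}^+=[1,3]^n\times[2,3]$ and $\mathcal{C}^-=[1,3]^n\times[1,2]$. Assign to each integer-lattice unit cube $Q$ of $[0,4]^{n+1}$ the height $h(Q)=4$ if $Q\subset\mathcal{C}^+$, $h(Q)=0$ if $Q\subset\mathcal{C}^-$, and $h(Q)=2$ otherwise. Let $$S=\bigcup_{Q:\,h(Q)>0} Q\times[0,h(Q)]\subset[0,4]^{n+2}.$$ Then $S$ is homeomorphic to $S^n\times D^2$. Moreover, if $r_\pi:\mathbb{R}^{n+2}\to\mathbb{R}^{n+2}$ denotes the rotation by $\pi$ about the $n$-plane $\{x_{n+1}=x_{n+2}=2\}$, then $S\cup r_\pi(S)=[0,4]^{n+2}$ and $S$, $r_\pi(S)$ have disjoint interiors; consequently $S$ is a rep-tile.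
   Context: Here $S^n$ is the $n$-sphere ($S^0$ is two points) and $D^2$ the closed disk. A rep-tile in $\mathbb{R}^m$ is a subset $X\subset\mathbb{R}^m$ with non-empty interior which can be written as a finite union $X=\bigcup_{i=1}^{k}X_i$ with $k\ge 2$, where the sets $X_i$ are pairwise isometric, each $X_i$ is similar to $X$ (i.e. is the image of $X$ under a similarity of $\mathbb{R}^m$), and $X_i$, $X_j$ have disjoint interiors whenever $i\ne j$. (Connectedness is not required.) *)

theory Defs
  imports "HOL-Analysis.Analysis"
begin

subsection \<open>Rep-tiles\<close>

definition isometric_sets :: "'a::metric_space set \<Rightarrow> 'b::metric_space set \<Rightarrow> bool" where
  "isometric_sets A B \<longleftrightarrow> (\<exists>f. f ` A = B \<and> (\<forall>x\<in>A. \<forall>y\<in>A. dist (f x) (f y) = dist x y))"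

(* Surjectivity is automatic on a finite-dimensional space. *)
definition similarity :: "('a::euclidean_space \<Rightarrow> 'a) \<Rightarrow> bool" where
  "similarity f \<longleftrightarrow> (\<exists>c>0. \<forall>x y. dist (f x) (f y) = c * dist x y)"

definition similar_sets :: "'a::euclidean_space set \<Rightarrow> 'a set \<Rightarrow> bool" where
  "similar_sets A B \<longleftrightarrow> (\<exists>f. similarity f \<and> f ` A = B)"

definition rep_tile :: "'a::euclidean_space set \<Rightarrow> bool" where
  "rep_tile X \<longleftrightarrow> interior X \<noteq> {} \<and>
     (\<exists>(k::nat) Y. k \<ge> 2 \<and> X = (\<Union>i\<in>{1..k}. Y i) \<and>
        (\<forall>i\<in>{1..k}. \<forall>j\<in>{1..k}. isometric_sets (Y i) (Y j)) \<and>
        (\<forall>i\<in>{1..k}. similar_sets X (Y i)) \<and>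
        (\<forall>i\<in>{1..k}. \<forall>j\<in>{1..k}. i \<noteq> j \<longrightarrow> interior (Y i) \<inter> interior (Y j) = {}))"

subsection \<open>The cubical tile\<close>

text \<open>
  Euclidean space of dimension \<open>n + 1\<close> is \<open>real ^ 'k\<close> with \<open>CARD('k) = n + 1\<close>. The type \<open>'k\<close> carries
  no order, so the index \<open>p\<close> of the coordinate \<open>x\<^sub>n\<^sub>+\<^sub>1\<close> is an explicit parameter. Euclidean space of
  dimension \<open>n + 2\<close> is \<open>(real ^ 'k) \<times> real\<close>, whose norm is the Euclidean one; the second component
  is the coordinate \<open>x\<^sub>n\<^sub>+\<^sub>2\<close>. A numeral \<open>c\<close> as a vector, \<open>vec c\<close>, has all entries \<open>c\<close>.
\<close>

definition lattice_cubes :: "(real ^ 'k) set set" where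
  "lattice_cubes = {Q. \<exists>z. (\<forall>i. z $ i \<in> \<int>) \<and> Q = cbox z (z + vec 1) \<and> Q \<subseteq> cbox (vec 0) (vec 4)}"

definition C_box :: "(real ^ 'k) set" where
  "C_box = cbox (vec 1) (vec 3)"

definition C_plus :: "'k \<Rightarrow> (real ^ 'k) set" where
  "C_plus p = cbox (\<chi> i. if i = p then 2 else 1) (vec 3)"

definition C_minus :: "'k \<Rightarrow> (real ^ 'k) set" where
  "C_minus p = cbox (vec 1) (\<chi> i. if i = p then 2 else 3)"

definition height :: "'k \<Rightarrow> (real ^ 'k) set \<Rightarrow> real" where
  "height p Q = (if Q \<subseteq> C_plus p then 4 else if Q \<subseteq> C_minus p then 0 else 2)"

definition S_tile :: "'k \<Rightarrow> ((real ^ 'k) \<times> real) set" where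
  "S_tile p = (\<Union>Q \<in> {Q \<in> lattice_cubes. height p Q > 0}. Q \<times> {0..height p Q})"

text \<open>Rotation by the angle \<open>\<theta>\<close> about the plane \<open>{x\<^sub>n\<^sub>+\<^sub>1 = x\<^sub>n\<^sub>+\<^sub>2 = 2}\<close> of codimension 2.\<close>

definition rotation :: "'k \<Rightarrow> real \<Rightarrow> (real ^ 'k) \<times> real \<Rightarrow> (real ^ 'k) \<times> real" where
  "rotation p \<theta> = (\<lambda>(x, t).
     (\<chi> i. if i = p then 2 + cos \<theta> * (x $ p - 2) - sin \<theta> * (t - 2) else x $ i,
      2 + sin \<theta> * (x $ p - 2) + cos \<theta> * (t - 2)))"

end

theory Submission
  imports Defs
begin

text \<open>
  The tile is \<open>A \<times> [0,2]\<close> with a tower \<open>C\<^sup>+ \<times> [2,4]\<close> on top, where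
  \<open>A = [0,4]\<^sup>n\<^sup>+\<^sup>1 - int C\<^sup>-\<close>. The tower can be squashed, fixing its base, to a pyramid over \<open>C\<^sup>+ \<subseteq> A\<close>;
  the result is the region under the graph of a positive continuous function on \<open>A\<close>, hence
  homeomorphic to \<open>A \<times> [0,1]\<close>, and \<open>A\<close> is an annulus \<open>S\<^sup>n \<times> [0,1]\<close> around the centre of \<open>C\<^sup>-\<close>.
  The rotation exchanges the missing block over \<open>C\<^sup>-\<close> with the tower, so the tile and its image fill
  the cube. Since the tile is also a union of unit cubes, replacing each of these by a quarter-size copy
  of the tile and of its rotated image exhibits it as a rep-tile.
\<close>

subsection \<open>Homeomorphisms\<close>

lemma homeomorphic_Times:
  assumes "A homeomorphic B" "C homeomorphic D"
  shows "A \<times> C homeomorphic B \<times> D"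
proof -
  obtain f f' where f: "homeomorphism A B f f'"
    using assms(1) by (auto simp: homeomorphic_def)
  obtain g g' where g: "homeomorphism C D g g'"
    using assms(2) by (auto simp: homeomorphic_def)
  have "homeomorphism (A \<times> C) (B \<times> D) (map_prod f g) (map_prod f' g')"
  proof (rule homeomorphismI)
    show "continuous_on (A \<times> C) (map_prod f g)"
      unfolding map_prod_def case_prod_beta
      using f g by (auto simp: homeomorphism_def intro!: continuous_on_Pair
          continuous_on_compose2[of A f _ fst] continuous_on_compose2[of C g _ snd] continuous_intros)
    show "continuous_on (B \<times> D) (map_prod f' g')"
      unfolding map_prod_def case_prod_beta
      using f g by (auto simp: homeomorphism_def intro!: continuous_on_Pair
          continuous_on_compose2[of B f' _ fst] continuous_on_compose2[of D g' _ snd] continuous_intros)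
  qed (use f g in \<open>auto simp: homeomorphism_def\<close>)
  then show ?thesis
    by (auto simp: homeomorphic_def)
qed

text \<open>On the ray through a unit vector \<open>u\<close> the set is the segment of radii from
  \<open>1 / g u\<close> to \<open>1 / h u\<close>. Working with positively homogeneous functions
  admits the non-symmetric gauge used later.\<close>

lemma homeomorphic_gauge_annulus:
  fixes g h :: "'a::euclidean_space \<Rightarrow> real"
  assumes cont: "continuous_on UNIV g" "continuous_on UNIV h"
    and g: "\<And>a x. a > 0 \<Longrightarrow> g (a *\<^sub>R x) = a * g x"
    and h: "\<And>a x. a > 0 \<Longrightarrow> h (a *\<^sub>R x) = a * h x"
    and h_pos: "\<And>x. x \<noteq> 0 \<Longrightarrow> 0 < h x"
    and h_less_g: "\<And>x. x \<noteq> 0 \<Longrightarrow> h x < g x"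
  shows "sphere (0::'a) 1 \<times> {0..1::real} homeomorphic {x. 1 \<le> g x \<and> h x \<le> 1}"
proof -
  let ?K = "sphere (0::'a) 1 \<times> {0..1::real}"
  define l where "l = (\<lambda>u \<theta>. (1 - \<theta>) / g u + \<theta> / h u)"
  define F where "F = (\<lambda>(u, \<theta>). l u \<theta> *\<^sub>R u)"
  have l_eq: "l u \<theta> = 1 / g u + \<theta> * (1 / h u - 1 / g u)" for u \<theta>
    by (simp add: l_def diff_divide_distrib right_diff_distrib)
  have gap: "0 < 1 / h u - 1 / g u" "0 < 1 / g u" "0 < h u" "0 < g u" if "norm u = 1" for u
  proof -
    have "u \<noteq> 0"
      using that by auto
    then show "0 < h u" and "0 < g u"
      using h_pos[of u] h_less_g[of u] by auto
    then show "0 < 1 / h u - 1 / g u" "0 < 1 / g u"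
      using h_less_g[OF \<open>u \<noteq> 0\<close>] by (auto simp: field_simps)
  qed
  have l_lower: "1 / g u \<le> l u \<theta>" and l_upper: "l u \<theta> \<le> 1 / h u" and l_pos: "0 < l u \<theta>"
    if "norm u = 1" "\<theta> \<in> {0..1}" for u \<theta>
  proof -
    have "0 \<le> \<theta> * (1 / h u - 1 / g u)" "\<theta> * (1 / h u - 1 / g u) \<le> 1 * (1 / h u - 1 / g u)"
      using gap[OF that(1)] that(2) by (auto intro!: mult_right_mono mult_nonneg_nonneg simp del: mult_1)
    then show lower: "1 / g u \<le> l u \<theta>" and "l u \<theta> \<le> 1 / h u"
      by (auto simp: l_eq)
    show "0 < l u \<theta>"
      using gap(2)[OF that(1)] lower by linarith
  qed
  have F_ne: "F w \<noteq> 0" and norm_F: "norm (F w) = l (fst w) (snd w)" if "w \<in> ?K" for w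
    using that l_pos[of "fst w" "snd w"] by (auto simp: F_def case_prod_beta)
  have inj: "inj_on F ?K"
  proof (rule inj_onI)
    fix w w' assume w: "w \<in> ?K" "w' \<in> ?K" and eq: "F w = F w'"
    have l: "l (fst w) (snd w) = l (fst w') (snd w')"
      using norm_F w eq by metis
    moreover have "l (fst w) (snd w) > 0"
      using l_pos w by auto
    ultimately have u: "fst w = fst w'"
      using eq by (auto simp: F_def case_prod_beta)
    have "norm (fst w') = 1"
      using w by auto
    then have "snd w = snd w'"
      using l gap(1)[of "fst w'"] by (auto simp: l_eq u)
    with u show "w = w'"
      by (simp add: prod_eq_iff)
  qed
  have "F ` ?K = {x. 1 \<le> g x \<and> h x \<le> 1}"
  proof (intro equalityI subsetI)
    fix x assume "x \<in> F ` ?K"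
    then obtain u \<theta> where u: "norm u = 1" "\<theta> \<in> {0..1}" and x: "x = l u \<theta> *\<^sub>R u"
      by (auto simp: F_def)
    note p = gap[OF u(1)] l_pos[OF u]
    have "g x = l u \<theta> * g u" "h x = l u \<theta> * h u"
      using g h p by (auto simp: x)
    then show "x \<in> {x. 1 \<le> g x \<and> h x \<le> 1}"
      using l_lower[OF u] l_upper[OF u] p by (auto simp: field_simps)
  next
    fix x assume "x \<in> {x. 1 \<le> g x \<and> h x \<le> 1}"
    then have x: "1 \<le> g x" "h x \<le> 1"
      by auto
    \<comment> \<open>Homogeneity with factor 2 gives \<open>g 0 = 2 * g 0\<close>, so
      \<open>1 \<le> g x\<close> excludes the origin.\<close>
    have "g 0 = 0"
      using g[of 2 0] by simp
    then have "x \<noteq> 0"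
      using x by auto
    define u where "u = x /\<^sub>R norm x"
    \<comment> \<open>Solves \<open>l u \<theta> = norm x\<close>, which is affine in
      \<open>\<theta>\<close>.\<close>
    define \<theta> where "\<theta> = (norm x - 1 / g u) / (1 / h u - 1 / g u)"
    have u: "norm u = 1" and x_eq: "x = norm x *\<^sub>R u"
      using \<open>x \<noteq> 0\<close> by (auto simp: u_def)
    note p = gap[OF u]
    have "g x = norm x * g u" "h x = norm x * h u"
      using g[of "norm x" u] h[of "norm x" u] \<open>x \<noteq> 0\<close> x_eq by auto
    then have "1 / g u \<le> norm x" "norm x \<le> 1 / h u"
      using x p by (auto simp: field_simps)
    then have "\<theta> \<in> {0..1}"
      using p by (auto simp: \<theta>_def)
    moreover have "l u \<theta> = norm x"
    proof -
      have "\<theta> * (1 / h u - 1 / g u) = norm x - 1 / g u"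
        using p(1) by (metis \<theta>_def less_irrefl nonzero_eq_divide_eq)
      then show ?thesis
        by (simp add: l_eq)
    qed
    ultimately show "x \<in> F ` ?K"
      using u x_eq by (intro image_eqI[of _ _ "(u, \<theta>)"]) (auto simp: F_def)
  qed
  moreover have "continuous_on ?K F"
  proof -
    have "continuous_on ?K (\<lambda>w. g (fst w))" "continuous_on ?K (\<lambda>w. h (fst w))"
      by (auto intro!: continuous_on_compose2[OF cont(1)] continuous_on_compose2[OF cont(2)] continuous_intros)
    moreover have "\<forall>w\<in>?K. g (fst w) \<noteq> 0" "\<forall>w\<in>?K. h (fst w) \<noteq> 0"
      using gap(3,4) by fastforce+
    ultimately show ?thesis
      unfolding F_def l_def case_prod_beta by (intro continuous_intros) auto
  qed
  ultimately show ?thesis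
    using inj by (intro homeomorphic_compact[of _ F]) (auto intro!: compact_Times)
qed

text \<open>Each vertical fibre is stretched by the positive factor \<open>f x\<close>; compactness
  of the domain makes the inverse continuous.\<close>

lemma homeomorphic_under_graph:
  fixes A :: "'a::t2_space set" and f :: "'a \<Rightarrow> real"
  assumes "compact A" "continuous_on A f" "\<And>x. x \<in> A \<Longrightarrow> 0 < f x"
  shows "A \<times> {0..1::real} homeomorphic {(x, t). x \<in> A \<and> 0 \<le> t \<and> t \<le> f x}"
proof (rule homeomorphic_compact[of _ "\<lambda>w. (fst w, snd w * f (fst w))"])
  show "continuous_on (A \<times> {0..1}) (\<lambda>w. (fst w, snd w * f (fst w)))"
    by (intro continuous_intros continuous_on_compose2[OF assms(2)]) auto
  show "inj_on (\<lambda>w. (fst w, snd w * f (fst w))) (A \<times> {0..1})"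
    using assms(3) by (force simp: inj_on_def)
  show "(\<lambda>w. (fst w, snd w * f (fst w))) ` (A \<times> {0..1}) = {(x, t). x \<in> A \<and> 0 \<le> t \<and> t \<le> f x}"
  proof (intro equalityI subsetI)
    fix w assume "w \<in> {(x, t). x \<in> A \<and> 0 \<le> t \<and> t \<le> f x}"
    then show "w \<in> (\<lambda>w. (fst w, snd w * f (fst w))) ` (A \<times> {0..1})"
      using assms(3)[of "fst w"]
      by (intro image_eqI[of _ _ "(fst w, snd w / f (fst w))"]) (auto simp: divide_simps)
  qed (use assms(3) in \<open>force simp: mult_le_cancel_right1 less_imp_le\<close>)
qed (use assms in \<open>auto intro: compact_Times\<close>)

text \<open>Compact convex sets of equal affine dimension are homeomorphic, and both sets have
  non-empty interior in a plane.\<close>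

lemma homeomorphic_disc_square:
  "cball (0::real^2) 1 homeomorphic {0..1::real} \<times> {0..1::real}"
proof -
  have "cbox (0::real,0::real) (1,1) = {0..1} \<times> {0..1}"
    by (simp add: cbox_Pair_eq)
  moreover have "cball (0::real^2) 1 homeomorphic cbox (0::real,0::real) (1,1)"
  proof (rule homeomorphic_convex_compact_sets)
    have "(1/2, 1/2) \<in> box (0::real,0::real) (1,1)"
      by (auto simp: box_def Basis_prod_def)
    then show "aff_dim (cball (0::real^2) 1) = aff_dim (cbox (0::real,0::real) (1,1))"
      by (subst (1 2) aff_dim_nonempty_interior) (auto simp: interior_cbox)
  qed (auto)
  ultimately show ?thesis
    by simp
qed

text \<open>
  The map \<open>(r, s) \<mapsto> ((1 - s/2) r, s (1 - r/2))\<close> sends the unit square onto the triangle \<open>a + b \<le> 1\<close>. It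
  preserves the difference of the coordinates and satisfies \<open>1 - a - b = (1 - r) (1 - s)\<close>, so
  \<open>1 - r\<close> and \<open>1 - s\<close> are recovered from their product and difference.
\<close>

lemma bilinear_square_to_triangle_surj:
  fixes a b :: real
  assumes "0 \<le> a" "0 \<le> b" "a + b \<le> 1"
  obtains r s where "0 \<le> r" "r \<le> 1" "0 \<le> s" "s \<le> 1" "(1 - s/2) * r = a" "s * (1 - r/2) = b"
proof
  define d where "d = a - b"
  \<comment> \<open>Plays the role of \<open>(1 - r) + (1 - s)\<close>: the square of a sum is the
    square of the difference plus four times the product.\<close>
  define D where "D = sqrt (d\<^sup>2 + 4 * (1 - a - b))"
  have D2: "D\<^sup>2 = d\<^sup>2 + 4 * (1 - a - b)"
    using assms by (simp add: D_def)
  have "\<bar>d\<bar> \<le> D"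
    unfolding D_def using assms by (intro real_le_rsqrt) auto
  \<comment> \<open>Equivalent to \<open>b \<ge> 0\<close> and \<open>a \<ge> 0\<close>; they lead
    to \<open>s \<ge> 0\<close> and \<open>r \<ge> 0\<close>.\<close>
  moreover have "d\<^sup>2 + 4 * (1 - a - b) \<le> (2 - d)\<^sup>2" "d\<^sup>2 + 4 * (1 - a - b) \<le> (2 + d)\<^sup>2"
    using assms by (simp_all add: d_def power2_eq_square algebra_simps)
  then have "D \<le> 2 - d" "D \<le> 2 + d"
    unfolding D_def using assms by (auto intro!: real_le_lsqrt simp: d_def)
  ultimately show "0 \<le> 1 - (D - d) / 2" "1 - (D - d) / 2 \<le> 1" "0 \<le> 1 - (D + d) / 2" "1 - (D + d) / 2 \<le> 1"
    by auto
  have "(1 - (1 - (D + d) / 2) / 2) * (1 - (D - d) / 2) = 1/2 + d/2 - (D\<^sup>2 - d\<^sup>2) / 8"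
    "(1 - (D + d) / 2) * (1 - (1 - (D - d) / 2) / 2) = 1/2 - d/2 - (D\<^sup>2 - d\<^sup>2) / 8"
    by (simp_all add: power2_eq_square field_simps)
  then show "(1 - (1 - (D + d) / 2) / 2) * (1 - (D - d) / 2) = a"
    "(1 - (D + d) / 2) * (1 - (1 - (D - d) / 2) / 2) = b"
    by (simp_all add: D2 d_def field_simps)
qed

lemma bilinear_square_to_triangle_inj:
  fixes r s r' s' :: real
  assumes "r \<le> 1" "s \<le> 1" "r' \<le> 1" "s' \<le> 1"
    and "(1 - s/2) * r = (1 - s'/2) * r'" "s * (1 - r/2) = s' * (1 - r'/2)"
  shows "s = s'"
proof -
  have diff: "r - s = r' - s'"
    using assms(5,6) by (simp add: field_simps)
  have prod: "(1 - r) * (1 - s) = (1 - r') * (1 - s')"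
    using assms(5,6) by (simp add: field_simps)
  \<comment> \<open>With \<open>r - s\<close> fixed, a larger \<open>s\<close> forces a larger
    \<open>r\<close>, so both factors of \<open>(1 - r) * (1 - s)\<close> shrink and the products
    cannot agree.\<close>
  have "\<not> s < s'"
    using mult_strict_mono'[of "1 - r'" "1 - r" "1 - s'" "1 - s"] diff prod assms(1-4) by auto
  moreover have "\<not> s' < s"
    using mult_strict_mono'[of "1 - r" "1 - r'" "1 - s" "1 - s'"] diff prod assms(1-4) by auto
  ultimately show ?thesis
    by simp
qed

text \<open>
  \<open>\<rho>\<close> is a gauge with unit ball the base of the tower; the square-to-triangle map acts on the
  pairs (gauge distance to the axis, normalised height).
\<close>

lemma homeomorphic_tower_pyramid:
  fixes A :: "'a::real_normed_vector set" and \<rho> :: "'a \<Rightarrow> real"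
  assumes "compact A" and sub: "{x. \<rho> (x - q) \<le> 1} \<subseteq> A"
    and cont: "continuous_on UNIV \<rho>"
    and nonneg: "\<And>y. 0 \<le> \<rho> y" and homog: "\<And>a y. a > 0 \<Longrightarrow> \<rho> (a *\<^sub>R y) = a * \<rho> y"
  shows "A \<times> {0..2::real} \<union> {x. \<rho> (x - q) \<le> 1} \<times> {2..4}
    homeomorphic {(x, t). x \<in> A \<and> 0 \<le> t \<and> t \<le> 2 + max 0 (1 - \<rho> (x - q))}"
    (is "?S homeomorphic ?P")
proof -
  define B where "B = {x. \<rho> (x - q) \<le> 1}"
  \<comment> \<open>\<open>s\<close> is 0 up to height 2 and rises linearly to 1 at height 4, so a
    single continuous formula for \<open>G\<close> is the identity on the base and the squashing on
    the tower.\<close>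
  define s where "s = (\<lambda>t::real. max 0 ((t - 2) / 2))"
  define G where "G = (\<lambda>(x, t). (q + (1 - s t / 2) *\<^sub>R (x - q), min t 2 + s t * (1 - \<rho> (x - q) / 2)))"
  have low: "G (x, t) = (x, t)" if "t \<le> 2" for x t
    using that by (auto simp: G_def s_def)
  have s_tower: "0 \<le> s t" "s t \<le> 1" if "t \<le> 4" for t
    using that by (auto simp: s_def)
  have high: "G (x, t) = (q + (1 - s t / 2) *\<^sub>R (x - q), 2 + s t * (1 - \<rho> (x - q) / 2))"
    if "2 \<le> t" for x t
    using that by (auto simp: G_def)
  have high_snd: "2 < snd (G (x, t))" if "2 < t" "x \<in> B" for x t
  proof -
    have "0 < s t * (1 - \<rho> (x - q) / 2)"
      using that by (intro mult_pos_pos) (auto simp: s_def B_def)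
    then show ?thesis
      using that by (simp add: high)
  qed
  have \<rho>_high: "\<rho> ((1 - s t / 2) *\<^sub>R (x - q)) = (1 - s t / 2) * \<rho> (x - q)" if "t \<le> 4" for x t
    using s_tower[OF that] by (intro homog) auto
  have tower: "x \<in> B \<and> 2 < t \<and> t \<le> 4" if "(x, t) \<in> ?S" "\<not> t \<le> 2" for x t
    using that by (auto simp: B_def)
  \<comment> \<open>Base and tower have images on different sides of height 2, so injectivity can be
    checked on each separately.\<close>
  have low_iff: "t \<le> 2 \<longleftrightarrow> snd (G (x, t)) \<le> 2" if "(x, t) \<in> ?S" for x t
    using that low[of t x] high_snd[of t x] tower[of x t] by (cases "t \<le> 2") auto
  have cont_sub: "continuous_on X (\<lambda>w. \<rho> (fst w - q))" for X :: "('a \<times> real) set"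
    by (auto intro!: continuous_on_compose2[OF cont] continuous_intros)
  have "inj_on G ?S"
  proof (rule inj_onI)
    fix w w' assume w: "w \<in> ?S" "w' \<in> ?S" and eq: "G w = G w'"
    obtain x t x' t' where xt: "w = (x, t)" "w' = (x', t')"
      by (cases w, cases w')
    show "w = w'"
    proof (cases "t \<le> 2 \<or> t' \<le> 2")
      case True
      moreover have "t \<le> 2 \<longleftrightarrow> t' \<le> 2"
        using low_iff w eq unfolding xt by metis
      ultimately have "t \<le> 2" "t' \<le> 2"
        by auto
      then show ?thesis
        using eq by (simp add: low xt)
    next
      case False
      then have x: "x \<in> B" "x' \<in> B" and t: "2 < t" "t \<le> 4" "2 < t'" "t' \<le> 4"
        using tower w by (auto simp: xt)
      have eq_x: "(1 - s t / 2) *\<^sub>R (x - q) = (1 - s t' / 2) *\<^sub>R (x' - q)"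
        and eq_t: "s t * (1 - \<rho> (x - q) / 2) = s t' * (1 - \<rho> (x' - q) / 2)"
        using eq t by (auto simp: xt high)
      have "s t = s t'"
      proof (rule bilinear_square_to_triangle_inj[OF _ _ _ _ _ eq_t])
        show "(1 - s t / 2) * \<rho> (x - q) = (1 - s t' / 2) * \<rho> (x' - q)"
          using eq_x \<rho>_high t by metis
      qed (use x t s_tower in \<open>auto simp: B_def\<close>)
      moreover have "1 - s t / 2 \<noteq> 0"
        using s_tower[OF t(2)] by auto
      ultimately show ?thesis
        using eq_x t by (auto simp: xt s_def)
    qed
  qed
  moreover have "G ` ?S = ?P"
  proof (intro equalityI subsetI)
    fix w assume "w \<in> G ` ?S"
    then obtain z where z: "z \<in> ?S" "w = G z"
      by blast
    obtain x t where xt: "(x, t) \<in> ?S" and w: "w = G (x, t)"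
      by (rule that[of "fst z" "snd z"]) (use z in simp_all)
    show "w \<in> ?P"
    proof (cases "t \<le> 2")
      case True
      then show ?thesis
        using xt sub by (auto simp: w low)
    next
      case False
      then have x: "x \<in> B" and t: "2 < t" "t \<le> 4"
        using tower xt by auto
      define r where "r = \<rho> (x - q)"
      have r: "0 \<le> r" "r \<le> 1"
        using x nonneg by (auto simp: r_def B_def)
      note s = s_tower[OF t(2)]
      have "(1 - s t / 2) * r \<le> 1"
        using r s by (intro mult_le_one) auto
      \<comment> \<open>The defining inequality of the triangle, a rearrangement of
        \<open>(1 - r) * (1 - s t) \<ge> 0\<close>.\<close>
      moreover have "s t * (1 - r / 2) \<le> 1 - (1 - s t / 2) * r"
        using mult_nonneg_nonneg[of "1 - r" "1 - s t"] r s by (simp add: field_simps)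
      moreover have "0 \<le> s t * (1 - r / 2)"
        using r s by auto
      ultimately show ?thesis
        using t sub by (auto simp: w high \<rho>_high simp flip: r_def)
    qed
  next
    fix w assume "w \<in> ?P"
    then obtain x t where w: "w = (x, t)" "x \<in> A" "0 \<le> t" "t \<le> 2 + max 0 (1 - \<rho> (x - q))"
      by auto
    show "w \<in> G ` ?S"
    proof (cases "t \<le> 2")
      case True
      then show ?thesis
        using w by (intro image_eqI[of _ _ "(x, t)"]) (auto simp: low)
    next
      case False
      then have le: "\<rho> (x - q) + (t - 2) \<le> 1" and "0 \<le> t - 2"
        using w(4) by (auto simp: max_def split: if_splits)
      then obtain a b where ab: "0 \<le> a" "a \<le> 1" "0 \<le> b" "b \<le> 1"
        and a: "(1 - b / 2) * a = \<rho> (x - q)" and b: "b * (1 - a / 2) = t - 2"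
        using bilinear_square_to_triangle_surj[OF nonneg _ le] by metis
      \<comment> \<open>Undoes the horizontal contraction, whose factor \<open>1 - b / 2\<close> is
        at least \<open>1 / 2\<close>; the height at which \<open>s\<close> equals \<open>b\<close>
        is \<open>2 + 2 * b\<close>.\<close>
      define y where "y = (1 / (1 - b / 2)) *\<^sub>R (x - q)"
      have "\<rho> y = 1 / (1 - b / 2) * \<rho> (x - q)"
        unfolding y_def using ab by (intro homog) auto
      then have \<rho>_y: "\<rho> y = a"
        using ab by (simp flip: a)
      have "s (2 + 2 * b) = b"
        using ab by (auto simp: s_def)
      moreover have "q + (1 - b / 2) *\<^sub>R y = x"
        using ab by (simp add: y_def)
      ultimately have "G (q + y, 2 + 2 * b) = w"
        using ab b by (simp add: high \<rho>_y w)
      moreover have "(q + y, 2 + 2 * b) \<in> ?S"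
        using ab \<rho>_y by auto
      ultimately show ?thesis
        by (metis imageI)
    qed
  qed
  moreover have "continuous_on ?S G"
    unfolding G_def s_def case_prod_beta by (intro continuous_intros cont_sub) auto
  moreover have "compact ?S"
  proof -
    have "{x. \<rho> (x - q) \<le> 1} = A \<inter> (\<lambda>x. \<rho> (x - q)) -` {..1}"
      using sub by auto
    moreover have "closed ((\<lambda>x. \<rho> (x - q)) -` {..1})"
      by (intro closed_vimage closed_atMost continuous_on_compose2[OF cont] continuous_intros) auto
    ultimately show ?thesis
      using \<open>compact A\<close> by (auto intro!: compact_Un compact_Times compact_Int_closed)
  qed
  ultimately show ?thesis
    by (intro homeomorphic_compact[of _ G])
qed

subsection \<open>Rep-tiles from a bisected body\<close>

text \<open>By substitution: \<open>S\<close> is cut into scaled copies of \<open>K\<close>, and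
  each of those into a scaled copy of \<open>S\<close> and one of its image under \<open>r\<close>.
  This gives \<open>2 * card Z\<close> pieces.\<close>

lemma rep_tileI_two_tiled:
  fixes S K :: "'a::euclidean_space set" and r :: "'a \<Rightarrow> 'a"
  assumes int: "interior S \<noteq> {}"
    and iso: "\<And>x y. dist (r x) (r y) = dist x y"
    and K: "S \<union> r ` S = K" and disj: "interior S \<inter> interior (r ` S) = {}"
    and c: "0 < c" and Z: "finite Z" "S = (\<Union>v\<in>Z. (\<lambda>x. v + c *\<^sub>R x) ` K)"
    and disj_Z: "\<And>v w. v \<in> Z \<Longrightarrow> w \<in> Z \<Longrightarrow> v \<noteq> w \<Longrightarrow>
      interior ((\<lambda>x. v + c *\<^sub>R x) ` K) \<inter> interior ((\<lambda>x. w + c *\<^sub>R x) ` K) = {}"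
  shows "rep_tile S"
proof -
  define g where "g = (\<lambda>v x::'a. v + c *\<^sub>R x)"
  define f where "f = (\<lambda>(v, b) x. g v (if b then r x else x))"
  define I where "I = Z \<times> (UNIV :: bool set)"
  have "Z \<noteq> {}"
    using int Z by auto
  then have card_I: "2 \<le> card I" "finite I"
    using Z(1) by (auto simp: I_def card_cartesian_product Suc_le_eq card_gt_0_iff)
  then obtain h where h: "bij_betw h {1..card I} I"
    using ex_bij_betw_nat_finite_1 by blast
  have dist_f: "dist (f i x) (f i y) = c * dist x y" for i x y
  proof -
    have "dist (g v x) (g v y) = c * dist x y" for v x y
      using c by (simp add: g_def dist_norm flip: scaleR_diff_right)
    then show ?thesis
      by (auto simp: f_def case_prod_beta iso)
  qed
  have "similarity (f i)" for i
    using c dist_f by (auto simp: similarity_def)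
  then have similar: "similar_sets S (f i ` S)" for i
    unfolding similar_sets_def by blast
  have isometric: "isometric_sets (f i ` S) (f j ` S)" for i j
  proof -
    have "f i x = f i y \<Longrightarrow> x = y" for x y
      using dist_f[of i x y] c by auto
    then have "inv (f i) (f i x) = x" for x
      by (simp add: inj_def)
    then show ?thesis
      unfolding isometric_sets_def
      by (intro exI[of _ "f j \<circ> inv (f i)"]) (auto simp: dist_f image_image)
  qed
  have inj_g: "inj (g v)" and cont_g: "continuous (at x) (g v)" for v x
    using c by (auto simp: g_def inj_def intro!: continuous_intros)
  have sub_K: "f (v, b) ` S \<subseteq> g v ` K" for v b
    using K by (auto simp: f_def)
  have f_eq: "f (v, b) ` S = g v ` (if b then r ` S else S)" for v b
    by (auto simp: f_def)
  have disjoint: "interior (f i ` S) \<inter> interior (f j ` S) = {}" if "i \<in> I" "j \<in> I" "i \<noteq> j" for i j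
  proof -
    obtain v b w b' where ij: "i = (v, b)" "j = (w, b')"
      by (cases i, cases j)
    show ?thesis
    \<comment> \<open>Pieces of different blocks are separated by \<open>disj_Z\<close>, the two
      halves of one block by \<open>disj\<close>.\<close>
    proof (cases "v = w")
      case False
      then show ?thesis
        using disj_Z[of v w] that interior_mono[OF sub_K] by (fastforce simp: ij I_def g_def)
    next
      case True
      have "interior (g v ` S) \<subseteq> g v ` interior S" "interior (g v ` r ` S) \<subseteq> g v ` interior (r ` S)"
        by (simp_all add: interior_image_subset inj_g cont_g)
      moreover have "g v ` interior S \<inter> g v ` interior (r ` S) = {}"
        using disj inj_g by (simp flip: image_Int)
      ultimately show ?thesis
        using True that by (auto simp: ij f_eq split: if_splits)
    qed
  qed
  have "(\<Union>i\<in>{1..card I}. f (h i) ` S) = (\<Union>i\<in>h ` {1..card I}. f i ` S)"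
    by simp
  also have "\<dots> = (\<Union>i\<in>I. f i ` S)"
    using h by (simp only: bij_betw_imp_surj_on)
  also have "\<dots> = (\<Union>v\<in>Z. \<Union>b. f (v, b) ` S)"
    unfolding I_def by blast
  also have "\<dots> = (\<Union>v\<in>Z. g v ` (S \<union> r ` S))"
    by (simp add: f_eq UNIV_bool image_Un)
  also have "\<dots> = S"
    unfolding K g_def by (rule Z(2)[symmetric])
  finally have union: "S = (\<Union>i\<in>{1..card I}. f (h i) ` S)" ..
  have h_in: "h i \<in> I" if "i \<in> {1..card I}" for i
    using h that bij_betwE by blast
  have "h i \<noteq> h j" if "i \<in> {1..card I}" "j \<in> {1..card I}" "i \<noteq> j" for i j
    using h that by (metis bij_betw_imp_inj_on inj_onD)
  then have "interior (f (h i) ` S) \<inter> interior (f (h j) ` S) = {}"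
    if "i \<in> {1..card I}" "j \<in> {1..card I}" "i \<noteq> j" for i j
    using that by (intro disjoint h_in)
  then show ?thesis
    unfolding rep_tile_def
    by (intro conjI int exI[of _ "card I"] exI[of _ "\<lambda>i. f (h i) ` S"] card_I(1) union ballI impI
        isometric similar)
qed

subsection \<open>The tile as a base with a tower\<close>

text \<open>With non-zero weights the closed balls are boxes with half-widths proportional to
  \<open>1 / \<bar>k i\<bar>\<close>, so this is the gauge of a box centred at the origin.\<close>

definition weighted_infnorm :: "('k \<Rightarrow> real) \<Rightarrow> real^'k \<Rightarrow> real" where
  "weighted_infnorm k x = infnorm (\<chi> i. k i * x $ i)"

lemma weighted_infnorm_eq_Max: "weighted_infnorm k x = Max (range (\<lambda>i. \<bar>k i * x $ i\<bar>))"
proof -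
  have "(\<lambda>b. \<bar>(\<chi> i. k i * x $ i) \<bullet> b\<bar>) ` Basis = range (\<lambda>i. \<bar>k i * x $ i\<bar>)"
    by (auto simp: Basis_vec_def inner_axis image_iff)
  then show ?thesis
    by (simp add: weighted_infnorm_def infnorm_Max)
qed

lemma weighted_infnorm_le_iff: "weighted_infnorm k x \<le> a \<longleftrightarrow> (\<forall>i. \<bar>k i * x $ i\<bar> \<le> a)"
  by (simp add: weighted_infnorm_eq_Max)

lemma weighted_infnorm_less_iff: "weighted_infnorm k x < a \<longleftrightarrow> (\<forall>i. \<bar>k i * x $ i\<bar> < a)"
  by (simp add: weighted_infnorm_eq_Max)

lemma weighted_infnorm_nonneg: "0 \<le> weighted_infnorm k x"
  by (simp add: weighted_infnorm_def infnorm_pos_le)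

lemma weighted_infnorm_scaleR: "a > 0 \<Longrightarrow> weighted_infnorm k (a *\<^sub>R x) = a * weighted_infnorm k x"
proof -
  have "(\<chi> i. k i * (a *\<^sub>R x) $ i) = a *\<^sub>R (\<chi> i. k i * x $ i)"
    by (simp add: vec_eq_iff)
  then show "a > 0 \<Longrightarrow> weighted_infnorm k (a *\<^sub>R x) = a * weighted_infnorm k x"
    by (simp add: weighted_infnorm_def infnorm_mul)
qed

lemma weighted_infnorm_pos:
  assumes "\<And>i. k i \<noteq> 0" "x \<noteq> 0"
  shows "0 < weighted_infnorm k x"
proof -
  have "(\<chi> i. k i * x $ i) \<noteq> 0"
    using assms by (auto simp: vec_eq_iff)
  then show ?thesis
    by (simp add: weighted_infnorm_def infnorm_pos_lt)
qed

lemma continuous_on_weighted_infnorm: "continuous_on A (weighted_infnorm k)"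
  unfolding weighted_infnorm_def by (intro continuous_intros)

text \<open>The set \<open>A\<close> of the overview. Only the interior is removed, so the walls of
  the hole stay and the set is compact.\<close>

definition frame :: "'k \<Rightarrow> (real^'k) set" where
  "frame p = cbox (vec 0) (vec 4) - interior (C_minus p)"

lemma mem_C_plus: "x \<in> C_plus p \<longleftrightarrow> (\<forall>i. (if i = p then 2 else 1) \<le> x $ i \<and> x $ i \<le> 3)"
  by (auto simp: C_plus_def mem_box_cart)

lemma mem_C_minus: "x \<in> C_minus p \<longleftrightarrow> (\<forall>i. 1 \<le> x $ i \<and> x $ i \<le> (if i = p then 2 else 3))"
  by (auto simp: C_minus_def mem_box_cart)

lemma mem_interior_C_minus:
  "x \<in> interior (C_minus p) \<longleftrightarrow> (\<forall>i. 1 < x $ i \<and> x $ i < (if i = p then 2 else 3))"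
  by (auto simp: C_minus_def interior_cbox mem_box_cart)

lemma compact_frame: "compact (frame p)"
  by (auto simp: frame_def intro: compact_diff)

text \<open>The blocks \<open>C_plus p\<close> and \<open>C_minus p\<close> meet only where
  coordinate \<open>p\<close> is 2, outside the interior of \<open>C_minus p\<close>. This puts the
  foot of the tower in the base.\<close>

lemma C_plus_subset_frame: "C_plus p \<subseteq> frame p"
proof
  fix x assume "x \<in> C_plus p"
  then have x: "(if i = p then 2 else 1) \<le> x $ i" "x $ i \<le> 3" for i
    by (auto simp: mem_C_plus)
  have "0 \<le> x $ i \<and> x $ i \<le> 4" for i
    using x[of i] by (auto split: if_splits)
  moreover have "x \<notin> interior (C_minus p)"
    using x(1)[of p] by (auto simp: mem_interior_C_minus intro!: exI[of _ p])
  ultimately show "x \<in> frame p"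
    by (simp add: frame_def mem_box_cart)
qed

lemma C_plus_eq_ball:
  "C_plus p = {x. weighted_infnorm (\<lambda>i. if i = p then 2 else 1) (x - (\<chi> i. if i = p then 5/2 else 2)) \<le> 1}"
  by (auto simp: mem_C_plus weighted_infnorm_le_iff abs_le_iff algebra_simps split: if_splits)

text \<open>
  The centre \<open>c\<close> of \<open>C\<^sup>-\<close> is not the centre of \<open>[0,4]\<^sup>n\<^sup>+\<^sup>1\<close>, so the gauge \<open>h\<close> of the outer cube about \<open>c\<close> is
  not a norm: in the direction \<open>p\<close> the cube extends by \<open>5/2\<close> upwards and by \<open>3/2\<close> downwards.
\<close>

lemma sphere_Times_interval_homeomorphic_frame:
  "sphere (0::real^'k) 1 \<times> {0..1::real} homeomorphic frame (p::'k::finite)"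
proof -
  define c :: "real^'k" where "c = (\<chi> i. if i = p then 3/2 else 2)"
  \<comment> \<open>Gauge of \<open>C_minus p\<close> about its centre: half-width
    \<open>1/2\<close> in direction \<open>p\<close>, otherwise 1.\<close>
  define g :: "real^'k \<Rightarrow> real" where "g = weighted_infnorm (\<lambda>i. if i = p then 2 else 1)"
  define h' :: "real^'k \<Rightarrow> real" where "h' = weighted_infnorm (\<lambda>i. if i = p then 2/5 else 1/2)"
  \<comment> \<open>\<open>h'\<close> alone would reach \<open>5/2\<close> both ways in direction
    \<open>p\<close>; the second term stops it at \<open>3/2\<close> downwards.\<close>
  define h where "h = (\<lambda>y. max (h' y) (- (2/3) * y $ p))"
  \<comment> \<open>The hole is well inside the cube: \<open>h' y\<close> is at most
    \<open>g y / 2\<close>, the downward term at most \<open>g y / 3\<close>.\<close>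
  have less: "h y < g y" if "y \<noteq> 0" for y
  proof -
    have "0 < g y"
      unfolding g_def using that by (intro weighted_infnorm_pos) auto
    have "\<bar>(if i = p then 2 else 1) * y $ i\<bar> \<le> g y" for i
      using weighted_infnorm_le_iff[of "\<lambda>i. if i = p then 2 else 1" y "g y"] by (simp add: g_def)
    then have y: "\<bar>y $ i\<bar> \<le> g y" "\<bar>y $ p\<bar> \<le> g y / 2" for i
      using \<open>0 < g y\<close> by (force simp: abs_mult split: if_splits)+
    have "\<bar>(if i = p then 2/5 else 1/2) * y $ i\<bar> \<le> g y / 2" for i
      using y(1)[of i] y(2) by (auto simp: abs_mult)
    then have "h' y \<le> g y / 2"
      unfolding h'_def weighted_infnorm_le_iff by blast
    then show ?thesis
      using y(2) \<open>0 < g y\<close> by (auto simp: h_def)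
  qed
  have "sphere (0::real^'k) 1 \<times> {0..1::real} homeomorphic {y. 1 \<le> g y \<and> h y \<le> 1}"
  proof (rule homeomorphic_gauge_annulus)
    show "continuous_on UNIV g" "continuous_on UNIV h"
      by (auto simp: g_def h_def h'_def intro!: continuous_intros continuous_on_weighted_infnorm)
    show "g (a *\<^sub>R x) = a * g x" "h (a *\<^sub>R x) = a * h x" if "0 < a" for a x
      using that by (simp_all add: g_def h_def h'_def weighted_infnorm_scaleR max_mult_distrib_left)
    show "0 < h x" if "x \<noteq> 0" for x
    proof -
      have "0 < h' x"
        unfolding h'_def using that by (intro weighted_infnorm_pos) simp_all
      then show ?thesis
        by (simp add: h_def)
    qed
  qed (rule less)
  also have "{y. 1 \<le> g y \<and> h y \<le> 1} homeomorphic (+) c ` {y. 1 \<le> g y \<and> h y \<le> 1}"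
    by (rule homeomorphic_translation)
  also have "(+) c ` {y. 1 \<le> g y \<and> h y \<le> 1} = {x. 1 \<le> g (x - c) \<and> h (x - c) \<le> 1}"
    by (force simp: image_iff intro: exI[of _ "_ - c"])
  also have "\<dots> = frame p"
  proof -
    have "g (x - c) < 1 \<longleftrightarrow> x \<in> interior (C_minus p)" for x
      unfolding g_def weighted_infnorm_less_iff mem_interior_C_minus
      by (intro all_cong1) (auto simp: c_def abs_less_iff)
    moreover have "h (x - c) \<le> 1 \<longleftrightarrow> x \<in> cbox (vec 0) (vec 4)" for x
    proof -
      \<comment> \<open>The bound in direction \<open>p\<close> is repeated under the quantifier so
        that coordinates can be compared one by one. For \<open>i = p\<close> the weight allows -1
        to 4, and the extra bound cuts this to 0 to 4.\<close>
      have "h (x - c) \<le> 1 \<longleftrightarrow>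
          (\<forall>i. \<bar>(if i = p then 2/5 else 1/2) * (x - c) $ i\<bar> \<le> 1 \<and> - (2/3) * (x - c) $ p \<le> 1)"
        by (simp add: h_def h'_def weighted_infnorm_le_iff)
      also have "\<dots> \<longleftrightarrow> (\<forall>i. (0 \<le> x $ i \<and> x $ i \<le> 4) \<and> 0 \<le> x $ p)"
        by (intro all_cong1) (auto simp: c_def abs_le_iff field_simps)
      also have "\<dots> \<longleftrightarrow> x \<in> cbox (vec 0) (vec 4)"
        by (auto simp: mem_box_cart)
      finally show ?thesis .
    qed
    ultimately show ?thesis
      by (auto simp: frame_def simp flip: not_less)
  qed
  finally show ?thesis .
qed

text \<open>Both sides are compared with the region under the graph of
  \<open>2 + max 0 (1 - \<rho> (x - q))\<close>, the base carrying a pyramid instead of the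
  tower.\<close>

lemma frame_Times_homeomorphic_tower:
  fixes p :: "'k::finite"
  shows "frame p \<times> {0..1::real} homeomorphic frame p \<times> {0..2::real} \<union> C_plus p \<times> {2..4}"
proof -
  define q :: "real^'k" where "q = (\<chi> i. if i = p then 5/2 else 2)"
  define \<rho> :: "real^'k \<Rightarrow> real" where "\<rho> = weighted_infnorm (\<lambda>i. if i = p then 2 else 1)"
  have C_plus: "C_plus p = {x. \<rho> (x - q) \<le> 1}"
    by (simp add: C_plus_eq_ball \<rho>_def q_def)
  have cont: "continuous_on UNIV \<rho>"
    unfolding \<rho>_def by (rule continuous_on_weighted_infnorm)
  have "frame p \<times> {0..1::real} homeomorphic
      {(x, t). x \<in> frame p \<and> 0 \<le> t \<and> t \<le> 2 + max 0 (1 - \<rho> (x - q))}"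
    by (rule homeomorphic_under_graph)
      (auto simp: compact_frame intro!: continuous_intros continuous_on_compose2[OF cont])
  also have "\<dots> homeomorphic frame p \<times> {0..2::real} \<union> C_plus p \<times> {2..4}"
    unfolding C_plus
  proof (rule homeomorphic_sym[THEN iffD1, OF homeomorphic_tower_pyramid])
    show "0 \<le> \<rho> y" for y
      unfolding \<rho>_def by (rule weighted_infnorm_nonneg)
    show "\<rho> (a *\<^sub>R y) = a * \<rho> y" if "0 < a" for a y
      unfolding \<rho>_def using that by (rule weighted_infnorm_scaleR)
    show "{x. \<rho> (x - q) \<le> 1} \<subseteq> frame p"
      using C_plus_subset_frame[of p] by (simp add: C_plus)
  qed (simp_all add: compact_frame cont)
  finally show ?thesis .
qed

section \<open>Lattice cubes and the columns above them\<close>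

lemma mem_cube: "x \<in> cbox z (z + 1) \<longleftrightarrow> (\<forall>i. z $ i \<le> x $ i \<and> x $ i \<le> z $ i + 1)"
  for x z :: "real^'k::finite"
  by (simp add: mem_box_cart)

lemma lattice_cubesI:
  fixes z :: "real^'k::finite"
  assumes "\<And>i. z $ i \<in> \<int>" "\<And>i. 0 \<le> z $ i" "\<And>i. z $ i \<le> 3"
  shows "cbox z (z + 1) \<in> lattice_cubes"
  using assms by (auto simp: lattice_cubes_def subset_interval_cart intro!: exI[of _ z])

text \<open>Names the integer coordinates \<open>m\<close> of the lower corner, so that strict real
  bounds can be sharpened to integral ones.\<close>

lemma lattice_cubesE:
  assumes "Q \<in> lattice_cubes"
  obtains z :: "real^'k::finite" and m where "Q = cbox z (z + 1)"
    "\<And>i. z $ i = of_int (m i)" "\<And>i. 0 \<le> m i" "\<And>i. m i \<le> 3"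
proof -
  obtain z where z: "\<forall>i. z $ i \<in> \<int>" "Q = cbox z (z + 1)" "Q \<subseteq> cbox (vec 0) (vec 4)"
    using assms by (auto simp: lattice_cubes_def)
  then have range: "0 \<le> z $ i" "z $ i \<le> 3" for i
    by (auto simp: subset_interval_cart)
  have "z $ i = of_int \<lfloor>z $ i\<rfloor>" for i
    using z(1) Ints_cases[of "z $ i"] by (metis floor_of_int)
  moreover have "0 \<le> \<lfloor>z $ i\<rfloor>" "\<lfloor>z $ i\<rfloor> \<le> 3" for i
    using range[of i] by (simp_all add: floor_le_iff)
  ultimately show thesis
    using that[of z "\<lambda>i. \<lfloor>z $ i\<rfloor>"] z(2) by blast
qed

lemma cube_subset_C_plus_iff:
  fixes p :: "'k::finite"
  shows "cbox z (z + 1) \<subseteq> C_plus p \<longleftrightarrow> (\<forall>i. (if i = p then 2 else 1) \<le> z $ i \<and> z $ i \<le> 2)"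
  by (auto simp: C_plus_def subset_interval_cart)

lemma cube_subset_C_minus_iff:
  fixes p :: "'k::finite"
  shows "cbox z (z + 1) \<subseteq> C_minus p \<longleftrightarrow> (\<forall>i. 1 \<le> z $ i \<and> z $ i \<le> (if i = p then 1 else 2))"
proof -
  have "z $ i + 1 \<le> (if i = p then 2 else 3) \<longleftrightarrow> z $ i \<le> (if i = p then 1 else 2)" for i
    by auto
  then show ?thesis
    by (auto simp: C_minus_def subset_interval_cart)
qed

text \<open>A lattice cube contains the centre exactly when every coordinate of its lower corner is
  1 or 2.\<close>

lemma Union_lattice_cubes_at_centre:
  "(C_box :: (real^'k::finite) set) = \<Union>{Q \<in> lattice_cubes. vec 2 \<in> Q}"
proof (intro equalityI subsetI)
  fix x :: "real^'k" assume "x \<in> C_box"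
  then have x: "1 \<le> x $ i" "x $ i \<le> 3" for i
    by (auto simp: C_box_def mem_box_cart)
  define z :: "real^'k" where "z = (\<chi> i. if x $ i \<le> 2 then 1 else 2)"
  have "cbox z (z + 1) \<in> lattice_cubes"
    by (rule lattice_cubesI) (simp_all add: z_def)
  moreover have "vec 2 \<in> cbox z (z + 1)" "x \<in> cbox z (z + 1)"
    using x by (simp_all add: mem_cube z_def)
  ultimately show "x \<in> \<Union>{Q \<in> lattice_cubes. vec 2 \<in> Q}"
    by blast
next
  fix x :: "real^'k" assume "x \<in> \<Union>{Q \<in> lattice_cubes. vec 2 \<in> Q}"
  then obtain Q where Q: "Q \<in> lattice_cubes" "vec 2 \<in> Q" "x \<in> Q"
    by blast
  then obtain z :: "real^'k" where "Q = cbox z (z + 1)"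
    by (auto elim: lattice_cubesE)
  then have "z $ i \<le> 2 \<and> 2 \<le> z $ i + 1" "z $ i \<le> x $ i \<and> x $ i \<le> z $ i + 1" for i
    using Q(2,3) by (simp_all add: mem_cube)
  then have "1 \<le> x $ i \<and> x $ i \<le> 3" for i
    by (smt (verit))
  then show "x \<in> C_box"
    by (simp add: C_box_def mem_box_cart)
qed

text \<open>\<open>C_minus p\<close> is itself made of lattice cubes, so a lattice cube not inside
  it misses its interior.\<close>

lemma frame_eq_Union_cubes:
  fixes p :: "'k::finite"
  shows "frame p = \<Union>{Q \<in> lattice_cubes. \<not> Q \<subseteq> C_minus p}"
proof (intro equalityI subsetI)
  fix x assume x: "x \<in> frame p"
  then have range: "0 \<le> x $ i" "x $ i \<le> 4" for i
    by (auto simp: frame_def mem_box_cart)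
  \<comment> \<open>On a wall of the hole the cube must lie on the outer side: coordinate 1 gets
    corner 0, coordinate 3 gets corner 3, and in direction \<open>p\<close> the floor gives corner 2
    to coordinate 2.\<close>
  define z :: "real^'k"
    where "z = (\<chi> i. if x $ i \<le> 1 then 0 else if x $ i \<ge> 3 then 3 else of_int \<lfloor>x $ i\<rfloor>)"
  have z: "z $ i \<in> \<int>" "0 \<le> z $ i" "z $ i \<le> 3" "z $ i \<le> x $ i" "x $ i \<le> z $ i + 1" for i
    using range[of i] by (simp_all add: z_def)
  obtain i where i: "x $ i \<le> 1 \<or> (if i = p then 2 else 3) \<le> x $ i"
    using x by (auto simp: frame_def mem_interior_C_minus not_less)
  have "\<not> (1 \<le> z $ i \<and> z $ i \<le> (if i = p then 1 else 2))"
  proof (cases "x $ i \<le> 1")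
    case False
    then show ?thesis
      using i by (cases "i = p") (auto simp: z_def floor_eq_iff)
  qed (simp add: z_def)
  then have "\<not> cbox z (z + 1) \<subseteq> C_minus p"
    unfolding cube_subset_C_minus_iff by blast
  moreover have "cbox z (z + 1) \<in> lattice_cubes" "x \<in> cbox z (z + 1)"
    using z by (simp_all add: lattice_cubesI mem_cube)
  ultimately show "x \<in> \<Union>{Q \<in> lattice_cubes. \<not> Q \<subseteq> C_minus p}"
    by blast
next
  fix x assume "x \<in> \<Union>{Q \<in> lattice_cubes. \<not> Q \<subseteq> C_minus p}"
  then obtain Q where Q: "Q \<in> lattice_cubes" "\<not> Q \<subseteq> C_minus p" "x \<in> Q"
    by blast
  obtain z m where z: "Q = cbox z (z + 1)" "\<And>i. z $ i = of_int (m i)"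
    and m: "\<And>i. 0 \<le> m i" "\<And>i. m i \<le> 3"
    by (rule lattice_cubesE[OF Q(1)]) blast
  have x: "of_int (m i) \<le> x $ i" "x $ i \<le> of_int (m i) + 1" for i
    using Q(3) by (simp_all add: z mem_cube)
  have "x \<notin> interior (C_minus p)"
  proof
    assume "x \<in> interior (C_minus p)"
    then have int: "1 < x $ i" "x $ i < (if i = p then 2 else 3)" for i
      by (auto simp: mem_interior_C_minus)
    have "1 \<le> z $ i \<and> z $ i \<le> (if i = p then 1 else 2)" for i
    proof -
      have "0 < real_of_int (m i)" "real_of_int (m i) < (if i = p then 2 else 3)"
        using less_le_trans[OF int(1)[of i] x(2)[of i]] le_less_trans[OF x(1)[of i] int(2)[of i]] by auto
      then show ?thesis
        by (cases "i = p") (simp_all add: z(2))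
    qed
    then show False
      using Q(2) unfolding z(1) cube_subset_C_minus_iff by blast
  qed
  moreover have "0 \<le> x $ i \<and> x $ i \<le> 4" for i
    using x[of i] m[of i] by linarith
  ultimately show "x \<in> frame p"
    by (simp add: frame_def mem_box_cart)
qed

lemma C_plus_eq_Union_cubes:
  fixes p :: "'k::finite"
  shows "C_plus p = \<Union>{Q \<in> lattice_cubes. Q \<subseteq> C_plus p}"
proof (intro equalityI subsetI)
  fix x assume "x \<in> C_plus p"
  then have x: "(if i = p then 2 else 1) \<le> x $ i" "x $ i \<le> 3" for i
    by (auto simp: mem_C_plus)
  define z :: "real^'k" where "z = (\<chi> i. if i = p \<or> 2 < x $ i then 2 else 1)"
  have "x \<in> cbox z (z + 1)"
    unfolding mem_cube
  proof
    fix i show "z $ i \<le> x $ i \<and> x $ i \<le> z $ i + 1"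
      using x[of i] by (auto simp: z_def split: if_splits)
  qed
  moreover have "cbox z (z + 1) \<in> lattice_cubes"
    by (rule lattice_cubesI) (simp_all add: z_def)
  moreover have "cbox z (z + 1) \<subseteq> C_plus p"
    unfolding cube_subset_C_plus_iff by (simp add: z_def)
  ultimately show "x \<in> \<Union>{Q \<in> lattice_cubes. Q \<subseteq> C_plus p}"
    by blast
qed auto

text \<open>In direction \<open>p\<close> the cubes under the tower start at 2 or above, those of
  the hole at 1 or below. So every cube of height 4 is also a cube of the base.\<close>

lemma cube_not_in_both:
  fixes p :: "'k::finite"
  assumes "Q \<in> lattice_cubes" "Q \<subseteq> C_plus p"
  shows "\<not> Q \<subseteq> C_minus p"
proof
  assume minus: "Q \<subseteq> C_minus p"
  obtain z where z: "Q = cbox z (z + 1)"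
    using assms(1) by (rule lattice_cubesE)
  have "2 \<le> z $ p"
    using assms(2) unfolding z cube_subset_C_plus_iff by presburger
  moreover have "z $ p \<le> 1"
    using minus unfolding z cube_subset_C_minus_iff by presburger
  ultimately show False
    by simp
qed

lemma S_tile_eq:
  fixes p :: "'k::finite"
  shows "S_tile p = frame p \<times> {0..2} \<union> C_plus p \<times> {2..4}"
proof -
  let ?N = "{Q \<in> lattice_cubes. \<not> Q \<subseteq> C_minus p}" and ?P = "{Q \<in> lattice_cubes. Q \<subseteq> C_plus p}"
  \<comment> \<open>A column of height 4 is counted once with height 2 and again in full, so that
    the part of height 2 is common to all columns.\<close>
  let ?u = "\<lambda>Q. if Q \<subseteq> C_plus p then Q \<times> {0..4::real} else {}"
  have "{Q \<in> lattice_cubes. height p Q > 0} = ?N"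
    using cube_not_in_both by (intro Collect_cong) (auto simp: height_def)
  then have "S_tile p = (\<Union>Q\<in>?N. Q \<times> {0..height p Q})"
    by (simp add: S_tile_def)
  also have "\<dots> = (\<Union>Q\<in>?N. Q \<times> {0..2} \<union> ?u Q)"
    by (intro SUP_cong) (auto simp: height_def)
  also have "\<dots> = (\<Union>Q\<in>?N. Q \<times> {0..2}) \<union> (\<Union>Q\<in>?N. ?u Q)"
    by (rule UN_Un_distrib)
  also have "(\<Union>Q\<in>?N. ?u Q) = (\<Union>Q\<in>?P. Q \<times> {0..4})"
  proof (intro equalityI UN_least)
    show "?u Q \<subseteq> (\<Union>Q\<in>?P. Q \<times> {0..4})" if "Q \<in> ?N" for Q
      using that by (cases "Q \<subseteq> C_plus p") auto
    show "Q \<times> {0..4} \<subseteq> (\<Union>Q\<in>?N. ?u Q)" if "Q \<in> ?P" for Q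
      by (rule order_trans[OF _ UN_upper[of Q]]) (use that cube_not_in_both[of Q p] in simp_all)
  qed
  also have "(\<Union>Q\<in>?N. Q \<times> {0..2::real}) \<union> (\<Union>Q\<in>?P. Q \<times> {0..4::real}) = \<Union>?N \<times> {0..2} \<union> \<Union>?P \<times> {0..4}"
    by blast
  also have "\<dots> = frame p \<times> {0..2} \<union> C_plus p \<times> {0..4}"
    by (simp only: frame_eq_Union_cubes[symmetric] C_plus_eq_Union_cubes[symmetric])
  also have "\<dots> = frame p \<times> {0..2} \<union> C_plus p \<times> {2..4}"
  proof -
    have "C_plus p \<times> {0..4} = C_plus p \<times> {0..2} \<union> C_plus p \<times> {2..4::real}"
      by auto
    moreover have "C_plus p \<times> {0..2} \<subseteq> frame p \<times> {0..2::real}"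
      using C_plus_subset_frame[of p] by (intro Sigma_mono) auto
    ultimately show ?thesis
      by (simp add: Un_absorb2 flip: Un_assoc)
  qed
  finally show ?thesis .
qed

subsection \<open>The rotated tile\<close>

text \<open>The rotation by \<open>pi\<close> negates \<open>x $ p\<close> and \<open>t\<close>
  about 2, so it splits into this reflection and \<open>t \<mapsto> 4 - t\<close>.\<close>

definition reflect :: "'k \<Rightarrow> real^'k \<Rightarrow> real^'k" where
  "reflect p x = (\<chi> i. if i = p then 4 - x $ p else x $ i)"

lemma rotation_pi: "rotation p pi (x, t) = (reflect p x, 4 - t)"
  by (simp add: rotation_def reflect_def vec_eq_iff)

lemma reflect_reflect [simp]: "reflect p (reflect p x) = x"
  by (simp add: reflect_def vec_eq_iff)

lemma dist_reflect: "dist (reflect p x) (reflect p y) = dist x y"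
  unfolding dist_vec_def
  by (intro arg_cong2[where f = L2_set] ext refl) (simp add: reflect_def dist_real_def abs_minus_commute)

lemma rotation_pi_involution: "rotation p pi (rotation p pi w) = w"
  by (cases w) (simp add: rotation_pi)

lemma dist_rotation_pi: "dist (rotation p pi v) (rotation p pi w) = dist v w"
  by (cases v, cases w) (simp add: rotation_pi dist_Pair_Pair dist_reflect, simp add: dist_real_def)

lemma mem_rotation_pi_image: "w \<in> rotation p pi ` X \<longleftrightarrow> rotation p pi w \<in> X"
  by (metis image_iff rotation_pi_involution)

text \<open>This is why the rotation places the tower exactly in the hole.\<close>

lemma reflect_mem_C_plus_iff: "reflect p x \<in> C_plus p \<longleftrightarrow> x \<in> C_minus p"
  for p :: "'k::finite"
  unfolding mem_C_plus mem_C_minus by (intro all_cong1) (auto simp: reflect_def)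

lemma reflect_mem_cbox_iff: "reflect p x \<in> cbox (vec 0) (vec 4) \<longleftrightarrow> x \<in> cbox (vec 0) (vec 4)"
  for p :: "'k::finite"
  unfolding mem_box_cart by (intro all_cong1) (auto simp: reflect_def)

text \<open>Up to height 2, a point over \<open>C_minus p\<close> is covered by the rotated tower
  and any other by the base. The rotation swaps the halves of the cube, which settles the upper
  half.\<close>

lemma S_tile_Un_rotation:
  fixes p :: "'k::finite"
  shows "S_tile p \<union> rotation p pi ` S_tile p = cbox (vec 0) (vec 4) \<times> {0..4}"
proof -
  have lower: "(x, t) \<in> S_tile p \<or> rotation p pi (x, t) \<in> S_tile p"
    if "x \<in> cbox (vec 0) (vec 4)" "0 \<le> t" "t \<le> 2" for x t
  proof (cases "x \<in> C_minus p")
    case True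
    then have "reflect p x \<in> C_plus p"
      by (simp add: reflect_mem_C_plus_iff)
    then show ?thesis
      using that by (simp add: S_tile_eq rotation_pi)
  next
    case False
    then have "x \<in> frame p"
      using that interior_subset[of "C_minus p"] by (auto simp: frame_def)
    then show ?thesis
      using that by (simp add: S_tile_eq)
  qed
  have in_cube: "x \<in> cbox (vec 0) (vec 4) \<and> 0 \<le> t \<and> t \<le> 4" if "(x, t) \<in> S_tile p" for x t
  proof -
    have "x \<in> frame p" "0 \<le> t \<and> t \<le> 4"
      using that C_plus_subset_frame[of p] by (auto simp: S_tile_eq)
    then show ?thesis
      by (auto simp: frame_def)
  qed
  have "(x, t) \<in> S_tile p \<or> rotation p pi (x, t) \<in> S_tile p \<longleftrightarrow>
      x \<in> cbox (vec 0) (vec 4) \<and> 0 \<le> t \<and> t \<le> 4" for x t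
  proof
    assume "(x, t) \<in> S_tile p \<or> rotation p pi (x, t) \<in> S_tile p"
    then show "x \<in> cbox (vec 0) (vec 4) \<and> 0 \<le> t \<and> t \<le> 4"
      using in_cube[of x t] in_cube[of "reflect p x" "4 - t"]
      unfolding rotation_pi reflect_mem_cbox_iff by linarith
  next
    assume *: "x \<in> cbox (vec 0) (vec 4) \<and> 0 \<le> t \<and> t \<le> 4"
    show "(x, t) \<in> S_tile p \<or> rotation p pi (x, t) \<in> S_tile p"
    proof (cases "t \<le> 2")
      case True
      then show ?thesis
        using * lower by blast
    next
      case False
      then have "(reflect p x, 4 - t) \<in> S_tile p \<or> rotation p pi (reflect p x, 4 - t) \<in> S_tile p"
        using * by (intro lower) (simp_all only: reflect_mem_cbox_iff, linarith+)
      then show ?thesis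
        by (auto simp: rotation_pi)
    qed
  qed
  then show ?thesis
    by (intro set_eqI) (simp only: split_paired_all Un_iff mem_rotation_pi_image mem_Times_iff
        fst_conv snd_conv atLeastAtMost_iff)
qed

text \<open>Projections are open maps, and a set minus its interior contains no non-empty open
  set.\<close>

lemma open_subset_boundary_Times_empty:
  fixes U :: "('a::topological_space \<times> 'b::topological_space) set"
  assumes "open U" "U \<subseteq> (C - interior C) \<times> UNIV"
  shows "U = {}"
proof -
  have "fst ` U \<subseteq> interior C"
    using assms by (intro interior_maximal open_image_fst) auto
  then show ?thesis
    using assms(2) by fastforce
qed

text \<open>Below height 2 a common point lies over the boundary of \<open>C_minus p\<close>, which
  has no room for an open set. The rotation carries this to heights above 2, and the level 2 alone
  has empty interior.\<close>

lemma disjoint_interiors_S_tile: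
  fixes p :: "'k::finite"
  shows "interior (S_tile p) \<inter> interior (rotation p pi ` S_tile p) = {}"
proof -
  let ?r = "rotation p pi"
  have cont: "continuous_on UNIV ?r"
    unfolding continuous_on_iff by (auto simp: dist_rotation_pi)
  have lower: "V \<inter> UNIV \<times> {..<2} = {}" if "open V" "V \<subseteq> S_tile p" "?r ` V \<subseteq> S_tile p" for V
  proof (intro open_subset_boundary_Times_empty[where C = "C_minus p"] open_Int open_Times)
    show "V \<inter> UNIV \<times> {..<2} \<subseteq> (C_minus p - interior (C_minus p)) \<times> UNIV"
    proof
      fix w assume w: "w \<in> V \<inter> UNIV \<times> {..<2}"
      obtain x t where xt: "w = (x, t)" "t < 2"
        using w by (cases w) auto
      have "(x, t) \<in> S_tile p" "(reflect p x, 4 - t) \<in> S_tile p"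
        using w that(2,3) by (auto simp: xt rotation_pi image_subset_iff)
      then have "x \<in> frame p" "reflect p x \<in> C_plus p"
        using \<open>t < 2\<close> by (auto simp: S_tile_eq)
      then show "w \<in> (C_minus p - interior (C_minus p)) \<times> UNIV"
        by (simp add: xt frame_def reflect_mem_C_plus_iff)
    qed
  qed (use that in auto)
  define U where "U = interior (S_tile p) \<inter> interior (?r ` S_tile p)"
  have "open U"
    by (auto simp: U_def)
  have "U \<subseteq> S_tile p" and sub': "U \<subseteq> ?r ` S_tile p"
    using interior_subset by (auto simp: U_def)
  have "?r ` ?r ` S_tile p = S_tile p"
    by (simp add: image_image rotation_pi_involution)
  then have "?r ` U \<subseteq> S_tile p"
    using image_mono[OF sub', of ?r] by simp
  have lower_U: "U \<inter> UNIV \<times> {..<2} = {}"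
    by (rule lower) fact+
  \<comment> \<open>The rotation is an involution, so this image is a preimage and therefore
    open.\<close>
  have "?r ` U = ?r -` U"
    by (auto simp: mem_rotation_pi_image rotation_pi_involution)
  then have "open (?r ` U)"
    using \<open>open U\<close> cont by (simp add: open_vimage)
  then have "?r ` U \<inter> UNIV \<times> {..<2} = {}"
    by (rule lower) (use \<open>U \<subseteq> S_tile p\<close> \<open>?r ` U \<subseteq> S_tile p\<close> in
      \<open>simp_all add: image_image rotation_pi_involution\<close>)
  then have upper: "\<not> 2 < t" if "(x, t) \<in> U" for x t
    using imageI[OF that, of ?r] by (auto simp: rotation_pi)
  have "U \<subseteq> UNIV \<times> {2}"
  proof
    fix w assume "w \<in> U"
    then show "w \<in> UNIV \<times> {2}"
      using upper lower_U by (cases w) force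
  qed
  then have "U \<subseteq> interior (UNIV \<times> {2})"
    using \<open>open U\<close> by (simp add: interior_maximal)
  then show ?thesis
    by (simp add: U_def interior_Times)
qed

subsection \<open>Subdivision into smaller tiles\<close>

lemma interior_S_tile_nonempty:
  fixes p :: "'k::finite"
  shows "interior (S_tile p) \<noteq> {}"
proof -
  \<comment> \<open>A corner block of the base: coordinate \<open>p\<close> stays below 1 and so
    avoids the hole.\<close>
  have "box (vec 0) (vec 1) \<times> {0<..<2} \<subseteq> S_tile p"
  proof -
    have "x \<in> frame p" if "x \<in> box (vec 0) (vec 1)" for x
    proof -
      have x: "0 < x $ i \<and> x $ i < 1" for i
        using that by (simp add: mem_box_cart)
      then have "0 \<le> x $ i \<and> x $ i \<le> 4" for i
        by (smt (verit))
      then show ?thesis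
        using x[of p] by (auto simp: frame_def mem_box_cart mem_interior_C_minus intro!: exI[of _ p])
    qed
    then show ?thesis
      by (auto simp: S_tile_eq)
  qed
  then have "box (vec 0) (vec 1) \<times> {0<..<2} \<subseteq> interior (S_tile p)"
    by (intro interior_maximal open_Times) auto
  moreover have "((\<chi> i. 1/2), 1) \<in> box (vec 0 :: real^'k) (vec 1) \<times> {0<..<2::real}"
    by (simp add: mem_box_cart)
  ultimately show ?thesis
    by blast
qed

lemma scaled_cube_eq:
  fixes v :: "(real^'k::finite) \<times> real"
  shows "(\<lambda>x. v + (1/4) *\<^sub>R x) ` (cbox (vec 0) (vec 4) \<times> {0..4})
    = cbox (fst v) (fst v + 1) \<times> {snd v..snd v + 1}"
proof -
  have "cbox (vec 0) (vec 4) \<times> {0..4} = cbox (vec 0 :: real^'k, 0::real) (vec 4, 4)"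
    by (simp add: cbox_Pair_eq)
  moreover have "(\<lambda>x. v + (1/4) *\<^sub>R x) = (\<lambda>x. (1/4) *\<^sub>R x + v)"
    by (simp add: add.commute)
  moreover have "cbox (vec 0 :: real^'k, 0::real) (vec 4, 4) \<noteq> {}"
    by (simp add: cbox_Pair_eq interval_ne_empty_cart)
  ultimately have "(\<lambda>x. v + (1/4) *\<^sub>R x) ` (cbox (vec 0) (vec 4) \<times> {0..4})
      = cbox ((1/4) *\<^sub>R (vec 0, 0) + v) ((1/4) *\<^sub>R (vec 4, 4) + v)"
    by (simp only: image_affinity_cbox) simp
  also have "(1/4) *\<^sub>R (vec 0, 0) + v = (fst v, snd v)"
    by (simp add: prod_eq_iff)
  also have "(1/4) *\<^sub>R (vec 4, 4) + v = (fst v + 1, snd v + 1)"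
    by (simp add: prod_eq_iff vec_eq_iff)
  finally show ?thesis
    unfolding cbox_Pair_eq by simp
qed

lemma finite_vec_range:
  fixes F :: "'a set"
  assumes "finite F"
  shows "finite {x :: 'a^'k::finite. \<forall>i. x $ i \<in> F}"
proof (rule finite_subset)
  show "{x :: 'a^'k. \<forall>i. x $ i \<in> F} \<subseteq> vec_lambda ` (UNIV \<rightarrow>\<^sub>E F)"
    by (auto simp: image_iff intro!: bexI[of _ "vec_nth _"])
qed (use assms in \<open>simp add: finite_PiE\<close>)

text \<open>These corners serve as the translation vectors \<open>Z\<close> of
  \<open>rep_tileI_two_tiled\<close>.\<close>

definition tile_cubes :: "'k \<Rightarrow> ((real^'k) \<times> real) set" where
  "tile_cubes p = {v. (\<forall>i. fst v $ i \<in> \<int>) \<and> snd v \<in> \<int> \<and>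
     cbox (fst v) (fst v + 1) \<times> {snd v..snd v + 1} \<subseteq> S_tile p}"

text \<open>A lower corner belongs to its own cube, hence to the big cube, which has finitely many
  lattice points.\<close>

lemma finite_tile_cubes:
  fixes p :: "'k::finite"
  shows "finite (tile_cubes p)"
proof -
  define F where "F = (of_int ` {0..4} :: real set)"
  have F: "a \<in> F" if "a \<in> \<int>" "0 \<le> a" "a \<le> 4" for a
    using that by (auto simp: F_def elim!: Ints_cases)
  have "tile_cubes p \<subseteq> {x. \<forall>i. x $ i \<in> F} \<times> F"
  proof
    fix v assume v: "v \<in> tile_cubes p"
    then have "(fst v, snd v) \<in> S_tile p"
      unfolding tile_cubes_def by (elim CollectE conjE subsetD) (simp add: mem_Times_iff mem_box_cart)
    then have "v \<in> cbox (vec 0) (vec 4) \<times> {0..4}"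
      using S_tile_Un_rotation[of p] by auto
    then have "0 \<le> fst v $ i \<and> fst v $ i \<le> 4" "0 \<le> snd v" "snd v \<le> 4" for i
      by (auto simp: mem_box_cart mem_Times_iff)
    then show "v \<in> {x. \<forall>i. x $ i \<in> F} \<times> F"
      using v by (auto simp: mem_Times_iff tile_cubes_def intro!: F)
  qed
  then show ?thesis
    by (rule finite_subset) (simp add: F_def finite_vec_range)
qed

text \<open>The heights are integers, so each column is a stack of unit cubes.\<close>

lemma S_tile_eq_Union_unit_cubes:
  fixes p :: "'k::finite"
  shows "S_tile p = (\<Union>v\<in>tile_cubes p. cbox (fst v) (fst v + 1) \<times> {snd v..snd v + 1})"
proof (intro equalityI subsetI)
  fix w assume "w \<in> S_tile p"
  then obtain Q where Q: "Q \<in> lattice_cubes" "height p Q > 0" "w \<in> Q \<times> {0..height p Q}"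
    by (auto simp: S_tile_def)
  then have sub: "Q \<times> {0..height p Q} \<subseteq> S_tile p"
    by (auto simp: S_tile_def)
  obtain z m where z: "Q = cbox z (z + 1)" "\<And>i. z $ i = of_int (m i)"
    by (rule lattice_cubesE[OF Q(1)]) blast
  \<comment> \<open>The level is the floor of \<open>snd w\<close>, except on the top face, where it
    is one less to stay inside the column.\<close>
  obtain k :: int where k: "0 \<le> k" "of_int k \<le> snd w" "snd w \<le> of_int k + 1" "of_int k + 1 \<le> height p Q"
  proof (cases "snd w = height p Q")
    case True
    have "height p Q = of_int (\<lfloor>height p Q\<rfloor> - 1) + 1" "1 \<le> \<lfloor>height p Q\<rfloor>"
      using Q(2) by (auto simp: height_def split: if_splits)
    then show ?thesis
      using True by (intro that[of "\<lfloor>height p Q\<rfloor> - 1"]) linarith+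
  next
    case False
    have "height p Q = of_int \<lfloor>height p Q\<rfloor>"
      by (auto simp: height_def)
    moreover have "snd w < height p Q" "0 \<le> snd w"
      using False Q(3) by (auto simp: mem_Times_iff)
    ultimately have "\<lfloor>snd w\<rfloor> < \<lfloor>height p Q\<rfloor>"
      by (simp add: floor_less_iff)
    then show ?thesis
      using \<open>0 \<le> snd w\<close> by (intro that[of "\<lfloor>snd w\<rfloor>"]) linarith+
  qed
  have "cbox z (z + 1) \<times> {of_int k..of_int k + 1} \<subseteq> Q \<times> {0..height p Q}"
    using k by (auto simp: z)
  then have "(z, of_int k) \<in> tile_cubes p"
    using sub by (auto simp: tile_cubes_def z(2))
  moreover have "w \<in> cbox z (z + 1) \<times> {of_int k..of_int k + 1}"
    using k Q(3) by (auto simp: z mem_Times_iff)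
  ultimately show "w \<in> (\<Union>v\<in>tile_cubes p. cbox (fst v) (fst v + 1) \<times> {snd v..snd v + 1})"
    by (intro UN_I[of "(z, of_int k)"]) simp_all
qed (auto simp: tile_cubes_def)

text \<open>Integers whose open unit intervals share a point differ by less than 1, so they
  agree.\<close>

lemma disjoint_interiors_unit_cubes:
  fixes v w :: "(real^'k::finite) \<times> real"
  assumes "\<forall>i. fst v $ i \<in> \<int>" "snd v \<in> \<int>" "\<forall>i. fst w $ i \<in> \<int>" "snd w \<in> \<int>" "v \<noteq> w"
  shows "interior (cbox (fst v) (fst v + 1) \<times> {snd v..snd v + 1}) \<inter>
    interior (cbox (fst w) (fst w + 1) \<times> {snd w..snd w + 1}) = {}"
proof (rule ccontr)
  assume "\<not> ?thesis"
  then obtain x t where x: "x \<in> box (fst v) (fst v + 1)" "x \<in> box (fst w) (fst w + 1)"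
    and t: "snd v < t" "t < snd v + 1" "snd w < t" "t < snd w + 1"
    by (auto simp: interior_Times interior_cbox)
  have "fst v $ i = fst w $ i" for i
  proof (rule Ints_eq_abs_less1[THEN iffD2])
    have "fst v $ i < x $ i" "x $ i < fst v $ i + 1" "fst w $ i < x $ i" "x $ i < fst w $ i + 1"
      using x by (auto simp: mem_box_cart)
    then show "\<bar>fst v $ i - fst w $ i\<bar> < 1"
      by linarith
  qed (use assms in auto)
  moreover have "snd v = snd w"
    by (rule Ints_eq_abs_less1[THEN iffD2]) (use assms t in auto)
  ultimately show False
    using \<open>v \<noteq> w\<close> by (simp add: prod_eq_iff vec_eq_iff)
qed

lemma rep_tile_S_tile:
  fixes p :: "'k::finite"
  shows "rep_tile (S_tile p)"
proof (rule rep_tileI_two_tiled[OF interior_S_tile_nonempty dist_rotation_pi S_tile_Un_rotation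
      disjoint_interiors_S_tile _ finite_tile_cubes, where c = "1/4"])
  show "S_tile p = (\<Union>v\<in>tile_cubes p. (\<lambda>x. v + (1/4) *\<^sub>R x) ` (cbox (vec 0) (vec 4) \<times> {0..4}))"
    unfolding scaled_cube_eq by (rule S_tile_eq_Union_unit_cubes)
  show "interior ((\<lambda>x. v + (1/4) *\<^sub>R x) ` (cbox (vec 0) (vec 4) \<times> {0..4})) \<inter>
      interior ((\<lambda>x. w + (1/4) *\<^sub>R x) ` (cbox (vec 0) (vec 4) \<times> {0..4})) = {}"
    if "v \<in> tile_cubes p" "w \<in> tile_cubes p" "v \<noteq> w" for v w
    unfolding scaled_cube_eq using that
    by (intro disjoint_interiors_unit_cubes) (auto simp: tile_cubes_def)
qed simp

text \<open>One interval factor is the thickness of the annulus, the other the height; together they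
  form a square, hence a disc.\<close>

lemma S_tile_homeomorphic:
  fixes p :: "'k::finite"
  shows "S_tile p homeomorphic (sphere (0 :: real^'k) 1 \<times> cball (0 :: real^2) 1)"
proof -
  have "S_tile p homeomorphic frame p \<times> {0..1::real}"
    unfolding S_tile_eq using frame_Times_homeomorphic_tower homeomorphic_sym by blast
  also have "frame p \<times> {0..1::real} homeomorphic (sphere (0 :: real^'k) 1 \<times> {0..1::real}) \<times> {0..1::real}"
    by (intro homeomorphic_Times homeomorphic_refl
        homeomorphic_sym[THEN iffD1, OF sphere_Times_interval_homeomorphic_frame])
  also have "\<dots> homeomorphic sphere (0 :: real^'k) 1 \<times> ({0..1::real} \<times> {0..1::real})"
    unfolding homeomorphic_minimal
    by (rule exI[of _ "\<lambda>((u, a), b). (u, a, b)"], rule exI[of _ "\<lambda>(u, a, b). ((u, a), b)"])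
      (auto simp: case_prod_beta intro!: continuous_intros)
  also have "\<dots> homeomorphic sphere (0 :: real^'k) 1 \<times> cball (0 :: real^2) 1"
    by (intro homeomorphic_Times homeomorphic_refl homeomorphic_sym[THEN iffD1, OF homeomorphic_disc_square])
  finally show ?thesis .
qed

theorem mainTheorem4:
  fixes n :: nat and p :: "'k::finite"
  assumes "CARD('k) = n + 1"
  shows "(C_box :: (real ^ 'k) set) = \<Union>{Q \<in> lattice_cubes. vec 2 \<in> Q}
    \<and> S_tile p homeomorphic (sphere (0 :: real ^ 'k) 1 \<times> cball (0 :: real ^ 2) 1)
    \<and> S_tile p \<union> rotation p pi ` S_tile p = cbox (vec 0) (vec 4) \<times> {0..4}
    \<and> interior (S_tile p) \<inter> interior (rotation p pi ` S_tile p) = {}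
    \<and> rep_tile (S_tile p)"
  by (intro conjI Union_lattice_cubes_at_centre S_tile_homeomorphic S_tile_Un_rotation
      disjoint_interiors_S_tile rep_tile_S_tile)

end
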